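(* Let $m\ge 1$ be an integer. Among all (finite simple) graphs $G$ with exactly $m$ edges, the colex graph $\mathcal{C}(m)$ maximizes $h(G)$, and therefore minimizes the first degree-based entropy $I(G)$.
   Context: For a graph $G$ with degree sequence $(d_i)_{1\le i\le n}$ and $m\ge1$ edges, the first degree-based entropy is $I(G)=-\sum_{i=1}^n \frac{d_i}{2m}\log\left(\frac{d_i}{2m}\right)$, and $h(G)=\sum_{i=1}^n f(d_i)$ where $f(x)=x\log x$ (with $f(0)=0$), so that $I(G)=\log(2m)-\frac{1}{2m}h(G)$. The colex graph $\mathcal{C}(m)$: write $m=\binom{k}{2}+\ell$ with integers $k\ge 2$ and $0\le \ell<k$; then $\mathcal{C}(m)$ is the graph obtained from a clique $K_k$ by adding one new vertex $v$ adjacent to exactly $\ell$ vertices of the clique. *)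

theory Defs
  imports Complex_Main
begin

record 'a ugraph =
  verts :: "'a set"
  edges :: "'a set set"

definition simple_graph :: "'a ugraph \<Rightarrow> bool" where
  "simple_graph G \<longleftrightarrow>
     finite (verts G) \<and> edges G \<subseteq> {e. e \<subseteq> verts G \<and> card e = 2}"

definition degree :: "'a ugraph \<Rightarrow> 'a \<Rightarrow> nat" where
  "degree G v = card {e \<in> edges G. v \<in> e}"

text \<open>The convention \<open>0 log 0 = 0\<close> holds automatically in the next two definitions,
  since the factor in front of the logarithm vanishes.\<close>

definition h_graph :: "'a ugraph \<Rightarrow> real" where
  "h_graph G = (\<Sum>v\<in>verts G. real (degree G v) * ln (real (degree G v)))"

definition degree_entropy :: "'a ugraph \<Rightarrow> real" where
  "degree_entropy G =
     - (\<Sum>v\<in>verts G. real (degree G v) / (2 * real (card (edges G)))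
                      * ln (real (degree G v) / (2 * real (card (edges G)))))"

text \<open>The clique has vertex set \<open>{..<k}\<close>; the additional vertex is \<open>k\<close> itself.\<close>

definition clique_plus_vertex :: "nat \<Rightarrow> nat \<Rightarrow> nat ugraph" where
  "clique_plus_vertex k l =
     \<lparr>verts = {..k},
      edges = {e. e \<subseteq> {..<k} \<and> card e = 2} \<union> {{i, k} | i. i < l}\<rparr>"

definition colex_decomp :: "nat \<Rightarrow> nat \<times> nat \<Rightarrow> bool" where
  "colex_decomp m = (\<lambda>(k, l). k \<ge> 2 \<and> l < k \<and> m = (k choose 2) + l)"

definition colex_graph :: "nat \<Rightarrow> nat ugraph" where
  "colex_graph m = (case (THE p. colex_decomp m p) of (k, l) \<Rightarrow> clique_plus_vertex k l)"

text \<open>For \<open>m \<ge> 1\<close> the definite description above is well defined.\<close>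

lemma Suc_choose_2: "Suc k choose 2 = (k choose 2) + k"
  by (simp add: numeral_2_eq_2)

lemma colex_decomp_mono:
  assumes "colex_decomp m (k, l)" "colex_decomp m (k', l')"
  shows "k \<le> k'"
proof (rule ccontr)
  assume "\<not> k \<le> k'"
  then have "Suc k' choose 2 \<le> k choose 2"
    by (intro binomial_right_mono) auto
  with assms show False
    by (simp add: colex_decomp_def Suc_choose_2)
qed

lemma colex_decomp_ex:
  assumes "m \<ge> 1"
  shows "\<exists>k l. colex_decomp m (k, l)"
  using assms
proof (induction m rule: dec_induct)
  case base
  have "colex_decomp 1 (2, 0)"
    by (simp add: colex_decomp_def)
  then show ?case by blast
next
  case (step m)
  then obtain k l where kl: "k \<ge> 2" "l < k" "m = (k choose 2) + l"
    by (auto simp: colex_decomp_def)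
  show ?case
  proof (cases "Suc l < k")
    case True
    with kl have "colex_decomp (Suc m) (k, Suc l)"
      by (simp add: colex_decomp_def)
    then show ?thesis by blast
  next
    case False
    with kl have "colex_decomp (Suc m) (Suc k, 0)"
      by (simp add: colex_decomp_def Suc_choose_2)
    then show ?thesis by blast
  qed
qed

lemma colex_decomp_ex1:
  assumes "m \<ge> 1"
  shows "\<exists>!p. colex_decomp m p"
proof -
  obtain k l where kl: "colex_decomp m (k, l)"
    using colex_decomp_ex[OF assms] by blast
  have "p = (k, l)" if "colex_decomp m p" for p
  proof (cases p)
    case (Pair k' l')
    with that kl have "k' = k"
      by (meson antisym colex_decomp_mono)
    with Pair that kl show ?thesis
      by (simp add: colex_decomp_def)
  qed
  with kl show ?thesis by blast
qed

end

theory Submission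
  imports Defs
begin

text \<open>
  Write \<open>f x = x ln x\<close> and \<open>m = (k choose 2) + l\<close>. By strict convexity of \<open>f\<close>, a graph maximising
  \<open>h\<close> has nested neighbourhoods. Let \<open>A\<close> be the \<open>k\<close> vertices of largest degree. Then the remaining
  vertices are independent and attached to a set \<open>B \<subseteq> A\<close> of \<open>b\<close> vertices, each of which is adjacent to
  all of \<open>A\<close>. If \<open>A\<close> misses \<open>q\<close> edges of a clique (all of them inside \<open>A - B\<close>), there are \<open>l + q\<close> edges
  outside \<open>A\<close>. Subadditivity of entropy, applied to the bipartite graph of these edges enlarged by
  \<open>k - 1\<close> columns joined to all of \<open>B\<close>, shows that the outside edges contribute at most
  \<open>f (b (k - 1) + l + q) - f (b (k - 1))\<close>. By the chord inequality the missing edges cost at least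
  \<open>2 q D\<close>, where \<open>D\<close> is the slope of \<open>f\<close> between \<open>b\<close> and \<open>k - 1\<close>. What remains is an
  inequality in \<open>k, l, b, q\<close>, with equality for the colex graph (\<open>q = 0\<close>, \<open>b = l\<close>).
\<close>

subsection \<open>The function x ln x\<close>

definition xlnx :: "real \<Rightarrow> real" where
  "xlnx x = x * ln x"

lemma xlnx_0 [simp]: "xlnx 0 = 0"
  by (simp add: xlnx_def)

lemma xlnx_mult:
  assumes "0 < x" "0 < y"
  shows "xlnx (x * y) = x * xlnx y + y * xlnx x"
  using assms by (simp add: xlnx_def ln_mult algebra_simps)

lemma xlnx_has_real_derivative [derivative_intros]:
  assumes "(g has_real_derivative g') (at z within T)" and "0 < g z"
  shows "((\<lambda>z. xlnx (g z)) has_real_derivative (1 + ln (g z)) * g') (at z within T)"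
  unfolding xlnx_def using assms
  by (auto intro!: derivative_eq_intros simp: field_simps)

text \<open>Convexity, reduced to \<open>ln z \<le> z - 1\<close> at \<open>z = x / y\<close>; the
  endpoint \<open>y = 0\<close> is treated apart.\<close>

lemma xlnx_tangent:
  assumes "0 < x" "0 \<le> y"
  shows "(y - x) * (1 + ln x) \<le> xlnx y - xlnx x"
proof (cases "y = 0")
  case True
  with assms show ?thesis by (simp add: xlnx_def algebra_simps)
next
  case False
  with assms have y: "0 < y" by simp
  have "y * ln (x / y) \<le> y * (x / y - 1)"
    using y assms by (intro mult_left_mono ln_le_minus_one) auto
  also have "\<dots> = x - y" using y by (simp add: field_simps)
  finally show ?thesis
    using y assms by (simp add: xlnx_def ln_div algebra_simps)
qed

text \<open>The tangent slope \<open>1 + ln x\<close> lies strictly below the increment after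
  \<open>x\<close> and not below the increment before \<open>y\<close>. This is the gain when an
  edge end moves from a vertex of degree \<open>y\<close> to one of degree \<open>x\<close>.\<close>

lemma xlnx_strict_exchange:
  fixes x y :: nat
  assumes "1 \<le> y" "y \<le> x"
  shows "xlnx (real x) + xlnx (real y) < xlnx (real (Suc x)) + xlnx (real (y - 1))"
proof -
  define c where "c = real x"
  have c: "0 < c" using assms by (simp add: c_def)
  have "(c + 1) * ln (c / (c + 1)) < (c + 1) * (c / (c + 1) - 1)"
  proof (intro mult_strict_left_mono)
    show "ln (c / (c + 1)) < c / (c + 1) - 1"
      using ln_eq_minus_one[of "c / (c + 1)"] ln_le_minus_one[of "c / (c + 1)"] c
      by (fastforce simp: less_le)
  qed (use c in auto)
  also have "\<dots> = - 1" using c by (simp add: field_simps)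
  finally have 1: "1 + ln c < xlnx (c + 1) - xlnx c"
    using c by (simp add: xlnx_def ln_div algebra_simps)
  have "(real (y - 1) - real y) * (1 + ln (real y)) \<le> xlnx (real (y - 1)) - xlnx (real y)"
    using assms by (intro xlnx_tangent) auto
  then have "xlnx (real y) - xlnx (real (y - 1)) \<le> 1 + ln (real y)"
    using assms by (simp add: of_nat_diff)
  also have "\<dots> \<le> 1 + ln c" using assms by (simp add: c_def)
  finally show ?thesis using 1 by (simp add: c_def algebra_simps)
qed

text \<open>The tangent at \<open>a + t\<close> bounds the increments on both sides of that point.
  Clearing denominators keeps \<open>w = 0\<close> admissible.\<close>

lemma xlnx_chord:
  assumes "0 < a" "0 \<le> t" "t \<le> w"
  shows "(xlnx (a + t) - xlnx a) * w \<le> t * (xlnx (a + w) - xlnx a)"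
proof -
  have 1: "xlnx (a + t) - xlnx a \<le> t * (1 + ln (a + t))"
    using xlnx_tangent[of "a + t" a] assms by (simp add: algebra_simps)
  have 2: "(w - t) * (1 + ln (a + t)) \<le> xlnx (a + w) - xlnx (a + t)"
    using xlnx_tangent[of "a + t" "a + w"] assms by (simp add: algebra_simps)
  have "(w - t) * (xlnx (a + t) - xlnx a) \<le> (w - t) * (t * (1 + ln (a + t)))"
    using 1 assms by (intro mult_left_mono) auto
  also have "\<dots> = t * ((w - t) * (1 + ln (a + t)))" by simp
  also have "\<dots> \<le> t * (xlnx (a + w) - xlnx (a + t))"
    using 2 assms by (intro mult_left_mono) auto
  finally show ?thesis by (simp add: algebra_simps)
qed

lemma xlnx_increment_mono:
  assumes "0 < x" "x \<le> y" "0 \<le> h"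
  shows "xlnx (x + h) - xlnx x \<le> xlnx (y + h) - xlnx y"
proof (rule DERIV_nonneg_imp_nondecreasing[OF assms(2)])
  fix z assume z: "x \<le> z" "z \<le> y"
  then have "((\<lambda>z. xlnx (z + h) - xlnx z) has_real_derivative ln (z + h) - ln z) (at z)"
    using assms by (auto intro!: derivative_eq_intros)
  moreover have "0 \<le> ln (z + h) - ln z" using z assms by simp
  ultimately show "\<exists>D. ((\<lambda>z. xlnx (z + h) - xlnx z) has_real_derivative D) (at z) \<and> 0 \<le> D"
    by blast
qed

section \<open>Sharper bounds for increments and chord slopes\<close>

text \<open>The derivative \<open>1 + ln z\<close> is concave, so its mean over an interval is at
  most its value at the midpoint. For \<open>x = 0\<close> the claim amounts to
  \<open>ln 2 \<le> 1\<close>.\<close>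

lemma xlnx_diff_le_midpoint:
  assumes "0 \<le> x" "x \<le> y" "0 < y"
  shows "xlnx y - xlnx x \<le> (y - x) * (1 + ln ((x + y) / 2))"
proof (cases "x = 0")
  case True
  have "y * ln 2 \<le> y * 1" using assms ln_2_less_1 by (intro mult_left_mono) auto
  with True assms show ?thesis by (simp add: xlnx_def ln_div algebra_simps)
next
  case False
  define F where "F z = (y - z) * (1 + ln ((z + y) / 2)) + xlnx z - xlnx y" for z
  have "F y \<le> F x"
  proof (rule DERIV_nonpos_imp_nonincreasing[OF assms(2)])
    fix z assume z: "x \<le> z" "z \<le> y"
    have z0: "0 < z" using z False assms by simp
    define D where "D = (y - z) / (z + y) - ln ((z + y) / 2) + ln z"
    have "z + y \<noteq> 0" using z0 assms by simp
    then have "(F has_real_derivative D) (at z)"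
      unfolding F_def D_def using z0 assms
      by (auto intro!: derivative_eq_intros, subst frac_eq_eq) (auto simp: algebra_simps)
    moreover have "ln (2 * z / (z + y)) \<le> 2 * z / (z + y) - 1"
      using z0 assms by (intro ln_le_minus_one) auto
    then have "D \<le> 0"
      using z0 assms by (simp add: D_def ln_div ln_mult field_simps)
    ultimately show "\<exists>D. (F has_real_derivative D) (at z) \<and> D \<le> 0" by blast
  qed
  then show ?thesis by (simp add: F_def)
qed

text \<open>The logarithmic mean of two numbers is at most their arithmetic mean, with denominators
  cleared.\<close>

lemma ln_diff_ge_rational:
  assumes "0 < (a::real)" "a \<le> c"
  shows "2 * (c - a) \<le> (c + a) * (ln c - ln a)"
proof -
  define F where "F z = (z + a) * (ln z - ln a) - 2 * (z - a)" for z :: real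
  have "F a \<le> F c"
  proof (rule DERIV_nonneg_imp_nondecreasing[OF assms(2)])
    fix z :: real assume z: "a \<le> z" "z \<le> c"
    with assms have z0: "0 < z" by simp
    then have "(F has_real_derivative (ln z - ln a) + a / z - 1) (at z)"
      unfolding F_def using assms
      by (auto intro!: derivative_eq_intros simp: field_simps)
    moreover have "ln (a / z) \<le> a / z - 1"
      using z0 assms by (intro ln_le_minus_one) auto
    then have "0 \<le> (ln z - ln a) + a / z - 1"
      using z0 assms by (simp add: ln_div)
    ultimately show "\<exists>D. (F has_real_derivative D) (at z) \<and> 0 \<le> D" by blast
  qed
  then show ?thesis by (simp add: F_def)
qed

text \<open>Concavity of \<open>1 + ln z\<close> from the other side: its mean over the interval is
  at least the average of its end values.\<close>

lemma xlnx_slope_ge_mean: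
  assumes "0 < a" "a < c"
  shows "2 + ln (a * c) \<le> 2 * ((xlnx c - xlnx a) / (c - a))"
proof -
  have "2 * (c - a) \<le> (c + a) * (ln c - ln a)"
    using assms by (intro ln_diff_ge_rational) auto
  then show ?thesis
    using assms by (simp add: ln_mult xlnx_def field_simps)
qed

text \<open>For \<open>a = b\<close> and \<open>c = k - 1\<close> the argument of the logarithm is \<open>b c + c + p (p - 1) / 4\<close> with \<open>p = k - b\<close>,
  the largest midpoint of an interval to which the midpoint bound is applied in \<open>tail_estimate\<close>.\<close>

lemma xlnx_slope_ge_log:
  assumes "1 \<le> a" "a < c"
  shows "1 + ln ((a + c)\<^sup>2 / 4 + (a + c) / 2 + 3 * (c - a) / 4)
    \<le> 2 * ((xlnx c - xlnx a) / (c - a))"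
proof -
  define t where "t = a / c"
  \<comment> \<open>Once \<open>1 \<le> a\<close> has turned the linear terms into quadratic ones,
    the argument of the logarithm is at most \<open>y * c\<^sup>2\<close>.\<close>
  define y where "y = (1 + 7 * t) / 4"
  have t: "0 < t" "t < 1" "a = t * c" "0 < c" using assms by (auto simp: t_def)
  have y: "0 < y" using t by (simp add: y_def)
  have "(a + c)\<^sup>2 / 4 + (a + c) / 2 + 3 * (c - a) / 4 = (a + c)\<^sup>2 / 4 + (5 * c - a) / 4"
    by (simp add: field_simps)
  also have "\<dots> \<le> (a + c)\<^sup>2 / 4 + a * (5 * c - a) / 4"
    using mult_right_mono[of 1 a "5 * c - a"] assms by linarith
  also have "\<dots> = y * c\<^sup>2"
    by (simp add: y_def t(3) power2_eq_square field_simps)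
  finally have "ln ((a + c)\<^sup>2 / 4 + (a + c) / 2 + 3 * (c - a) / 4) \<le> ln (y * c\<^sup>2)"
    using assms y t by (subst ln_le_cancel_iff) (auto intro!: add_pos_nonneg)
  also have "\<dots> = ln y + 2 * ln c" using y t by (simp add: ln_mult ln_realpow)
  finally have 1: "ln ((a + c)\<^sup>2 / 4 + (a + c) / 2 + 3 * (c - a) / 4) \<le> ln y + 2 * ln c" .
  \<comment> \<open>The tangent of \<open>ln\<close> at 1 suffices from \<open>t = 1 / 7\<close> on,
    the tangent at \<open>1 / 2\<close> below that value.\<close>
  have 2: "1 + ln y \<le> 4 * t / (1 + t)"
  proof (cases "1 / 7 \<le> t")
    case True
    have "ln y \<le> y - 1" using y by (rule ln_le_minus_one)
    moreover have "(7 * t - 1) * (t - 1) \<le> 0"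
      using True t by (intro mult_nonneg_nonpos) auto
    then have "y \<le> 4 * t / (1 + t)"
      using t by (simp add: y_def field_simps)
    ultimately show ?thesis by simp
  next
    case False
    have "ln (2 * y) \<le> 2 * y - 1" using y by (intro ln_le_minus_one) auto
    then have "ln y \<le> 2 * y - 1 - ln 2" using y by (simp add: ln_mult)
    moreover have "ln 2 \<ge> (1/2 :: real)" using ln_diff_ge_rational[of 1 2] by simp
    moreover have "7 * t / 2 \<le> 4 * t / (1 + t)"
      using False t by (simp add: field_simps)
    moreover have "2 * y = 1 / 2 + 7 * t / 2" by (simp add: y_def)
    ultimately show ?thesis by linarith
  qed
  have "2 * (1 - t) \<le> (1 + t) * (ln 1 - ln t)"
    using t by (intro ln_diff_ge_rational) auto
  moreover have "ln (c / a) = - ln t" using assms by (simp add: t_def ln_div)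
  ultimately have 3: "2 * (1 - t) / (1 + t) \<le> ln (c / a)"
    using t(1) by (simp add: pos_divide_le_eq mult.commute)
  have "4 * t / v = 2 * t / u * (2 * u / v)" if "u \<noteq> 0" for u v
    using that by simp
  from this[of "1 - t" "1 + t"]
  have "4 * t / (1 + t) = 2 * t / (1 - t) * (2 * (1 - t) / (1 + t))"
    using t(2) by simp
  also have "\<dots> \<le> 2 * t / (1 - t) * ln (c / a)"
    using 3 t by (intro mult_left_mono) auto
  also have "2 * t / (1 - t) = 2 * a / (c - a)"
    using assms by (simp add: t_def field_simps)
  finally have "1 + ln y \<le> 2 * a / (c - a) * ln (c / a)" using 2 by linarith
  also have "\<dots> = 2 * ((xlnx c - xlnx a) / (c - a)) - 2 * ln c"
    using assms by (simp add: xlnx_def ln_div field_simps)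
  finally show ?thesis using 1 by linarith
qed


text \<open>Weighs the gain from the outside edges against the cost of \<open>q\<close> missing
  clique edges, each charged \<open>2 * G\<close>. If \<open>b = c\<close>, division by zero makes
  \<open>G = 0\<close>, but then the bound on \<open>q\<close> forces \<open>q = 0\<close>.\<close>

lemma tail_estimate:
  fixes k l b :: nat and q c G :: real
  defines "c \<equiv> real k - 1"
  defines "G \<equiv> (xlnx c - xlnx b) / (c - b)"
  assumes b: "1 \<le> b" "b < k" and l: "l < k"
    and q: "0 \<le> q" "2 * q \<le> (real k - b) * (real k - b - 1)" "b \<le> l + q"
  shows "xlnx (b * c + l + q) - xlnx (b * c) \<le> xlnx l + l * (xlnx k - xlnx c) + 2 * q * G"
proof -
  have c: "real b \<le> c" "real l \<le> c" "1 \<le> c" "0 < c" "real k = c + 1"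
    using b l by (auto simp: c_def)
  \<comment> \<open>The right side is what a single new vertex joined to \<open>j\<close> vertices
    of a \<open>k\<close>-clique adds to the degree sum of \<open>xlnx\<close>.\<close>
  have rect: "xlnx (j * c + j) - xlnx (j * c) = xlnx j + j * (xlnx k - xlnx c)" if "1 \<le> j" for j :: nat
  proof -
    have "xlnx (j * (c + 1)) = j * xlnx (c + 1) + (c + 1) * xlnx j"
      "xlnx (j * c) = j * xlnx c + c * xlnx j"
      using that c by (auto intro!: xlnx_mult)
    then show ?thesis using c by (simp add: algebra_simps)
  qed
  \<comment> \<open>Beyond the exact part each further unit costs at most \<open>2 * G\<close>,
    because \<open>2 * G\<close> dominates \<open>1 + ln\<close> at the midpoint
    \<open>Z + r / 2\<close>.\<close>
  have step: "xlnx (Z + r) - xlnx Z \<le> 2 * r * G"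
    if "0 < Z" "Z \<le> b * c + c" "0 \<le> r" "r \<le> q" for Z r
  proof (cases "q = 0")
    case False
    have "b \<noteq> c" using False q by (auto simp: c_def)
    then have bc: "real b < c" using c by simp
    have "xlnx (Z + r) - xlnx Z \<le> r * (1 + ln (Z + r / 2))"
      using xlnx_diff_le_midpoint[of Z "Z + r"] that by (simp add: field_simps)
    also have "\<dots> \<le> r * (1 + ln ((b + c)\<^sup>2 / 4 + (b + c) / 2 + 3 * (c - b) / 4))"
    proof -
      have "Z + r / 2 \<le> b * c + c + q / 2" using that by simp
      also have "q \<le> (c + 1 - b) * (c - b) / 2" using q c by simp
      finally have "Z + r / 2 \<le> (b + c)\<^sup>2 / 4 + (b + c) / 2 + 3 * (c - b) / 4"
        by (simp add: field_simps power2_eq_square)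
      then show ?thesis
        using that by (intro mult_left_mono add_left_mono ln_mono) auto
    qed
    also have "\<dots> \<le> r * (2 * G)"
      unfolding G_def using that b bc
      by (intro mult_left_mono xlnx_slope_ge_log) auto
    finally show ?thesis by simp
  qed (use that in auto)
  \<comment> \<open>The first \<open>max b l\<close> outside edges are compared with a single vertex of that degree, where \<open>rect\<close> is exact.\<close>
  show ?thesis
  proof (cases "b \<le> l")
    case True
    have "xlnx (b * c + l) - xlnx (b * c) \<le> xlnx (l * c + l) - xlnx (l * c)"
      using b c True by (intro xlnx_increment_mono mult_right_mono mult_pos_pos) auto
    moreover have "xlnx (b * c + l + q) - xlnx (b * c + l) \<le> 2 * q * G"
      using b c q by (intro step add_pos_nonneg mult_pos_pos) auto
    ultimately show ?thesis using rect[of l] b True by simp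
  next
    case False
    \<comment> \<open>Of the \<open>q\<close> extra edges, \<open>b - l\<close> raise the exact part
      from degree \<open>l\<close> to degree \<open>b\<close>; the remaining \<open>r\<close> are
      left to \<open>step\<close>.\<close>
    define r where "r = q - (real b - real l)"
    have lb: "real l + 1 \<le> real b" using False by simp
    have "b \<noteq> c" using False q lb by (auto simp: c_def)
    then have bc: "real b < c" using c by simp
    have "xlnx b - xlnx l \<le> (real b - real l) * (1 + ln ((real l + real b) / 2))"
      using lb by (intro xlnx_diff_le_midpoint) auto
    \<comment> \<open>Integrality enters here: \<open>l \<le> b - 1\<close> keeps the midpoint at or
      below \<open>b - 1 / 2\<close>.\<close>
    also have "\<dots> \<le> (real b - real l) * (1 + ln (real b - 1 / 2))"
      using lb by (intro mult_left_mono add_left_mono ln_mono) auto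
    finally have 1: "xlnx b - xlnx l \<le> (real b - real l) * (1 + ln (real b - 1 / 2))" .
    have "xlnx k - xlnx c \<le> (real k - c) * (1 + ln ((c + real k) / 2))"
      using c by (intro xlnx_diff_le_midpoint) auto
    also have "\<dots> = 1 + ln (c + 1 / 2)" using c by (simp add: field_simps)
    finally have 2: "(real b - real l) * (xlnx k - xlnx c) \<le> (real b - real l) * (1 + ln (c + 1 / 2))"
      using lb by (intro mult_left_mono) auto
    \<comment> \<open>The half-unit shifts of the two midpoints compensate because
      \<open>b \<le> c\<close>.\<close>
    have "(real b - 1 / 2) * (c + 1 / 2) \<le> b * c"
      using c by (simp add: algebra_simps)
    then have "ln ((real b - 1 / 2) * (c + 1 / 2)) \<le> ln (b * c)"
      using lb c by (intro ln_mono mult_pos_pos) auto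
    then have "ln (real b - 1 / 2) + ln (c + 1 / 2) \<le> ln (b * c)"
      using lb c by (simp add: ln_mult_pos)
    moreover have "2 + ln (b * c) \<le> 2 * G"
      unfolding G_def using b bc by (intro xlnx_slope_ge_mean) auto
    ultimately have "(real b - real l) * (2 + ln (real b - 1 / 2) + ln (c + 1 / 2)) \<le> (real b - real l) * (2 * G)"
      using lb by (intro mult_left_mono) auto
    with 1 2 have 3: "xlnx b - xlnx l + (real b - real l) * (xlnx k - xlnx c) \<le> (real b - real l) * (2 * G)"
      by (simp add: algebra_simps)
    have "xlnx ((b * c + b) + r) - xlnx (b * c + b) \<le> 2 * r * G"
      using b c q lb by (intro step add_pos_nonneg mult_pos_pos) (auto simp: r_def)
    also have "(b * c + b) + r = b * c + l + q" by (simp add: r_def)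
    finally show ?thesis using rect[of b] b 3 by (simp add: r_def algebra_simps)
  qed
qed

subsection \<open>Entropy of bipartite graphs\<close>

lemma card_eq_sum_rows:
  assumes "finite X" "finite Y" "E \<subseteq> X \<times> Y"
  shows "card E = (\<Sum>x\<in>X. card {y. (x, y) \<in> E})"
proof -
  have "E = (SIGMA x:X. {y. (x, y) \<in> E})" using assms by auto
  moreover have "finite {y. (x, y) \<in> E}" for x
    by (rule finite_subset[of _ Y]) (use assms in auto)
  ultimately show ?thesis using assms card_SigmaI[of X "\<lambda>x. {y. (x, y) \<in> E}"] by simp
qed

lemma card_eq_sum_cols:
  assumes "finite X" "finite Y" "E \<subseteq> X \<times> Y"
  shows "card E = (\<Sum>y\<in>Y. card {x. (x, y) \<in> E})"
  using card_eq_sum_rows[of Y X "E\<inverse>"] assms by (auto simp: card_inverse)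

text \<open>Gibbs' inequality for a uniformly random edge against the product of its two marginals.\<close>

lemma bipartite_sum_xlnx_le:
  fixes E :: "('a \<times> 'b) set"
  assumes "finite X" "finite Y" "E \<subseteq> X \<times> Y"
  shows "(\<Sum>x\<in>X. xlnx (card {y. (x, y) \<in> E})) + (\<Sum>y\<in>Y. xlnx (card {x. (x, y) \<in> E}))
    \<le> xlnx (card E)"
proof (cases "E = {}")
  case False
  define R where "R x = real (card {y. (x, y) \<in> E})" for x
  define C where "C y = real (card {x. (x, y) \<in> E})" for y
  define N where "N = real (card E)"
  have fin: "finite E" using assms finite_subset by blast
  have N: "0 < N" using False fin by (simp add: N_def card_gt_0_iff)
  have ER: "E = (SIGMA x:X. {y. (x, y) \<in> E})" using assms by auto
  have finR: "finite {y. (x, y) \<in> E}" for x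
    by (rule finite_subset[of _ Y]) (use assms in auto)
  have finC: "finite {x. (x, y) \<in> E}" for y
    by (rule finite_subset[of _ X]) (use assms in auto)
  \<comment> \<open>Degree-weighted row sums become sums over edges, so that the logarithms can be
    combined edge by edge; likewise for columns below.\<close>
  have sumR: "(\<Sum>(x, y)\<in>E. w x) = (\<Sum>x\<in>X. R x * w x)" for w :: "'a \<Rightarrow> real"
  proof -
    have "(\<Sum>(x, y)\<in>E. w x) = (\<Sum>x\<in>X. \<Sum>y\<in>{y. (x, y) \<in> E}. w x)"
      by (subst ER, subst sum.Sigma) (use assms finR in auto)
    then show ?thesis by (simp add: R_def)
  qed
  have EC: "E = (\<lambda>(y, x). (x, y)) ` (SIGMA y:Y. {x. (x, y) \<in> E})" using assms by auto
  have sumC: "(\<Sum>(x, y)\<in>E. w y) = (\<Sum>y\<in>Y. C y * w y)" for w :: "'b \<Rightarrow> real"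
  proof -
    have "(\<Sum>(x, y)\<in>E. w y) = (\<Sum>(y, x)\<in>(SIGMA y:Y. {x. (x, y) \<in> E}). w y)"
      by (subst EC, subst sum.reindex) (auto simp: inj_on_def intro!: sum.cong)
    also have "\<dots> = (\<Sum>y\<in>Y. \<Sum>x\<in>{x. (x, y) \<in> E}. w y)"
      by (subst sum.Sigma) (use assms finC in auto)
    finally show ?thesis by (simp add: C_def)
  qed
  have totR: "(\<Sum>x\<in>X. R x) = N" using sumR[of "\<lambda>_. 1"] by (simp add: N_def case_prod_unfold)
  have totC: "(\<Sum>y\<in>Y. C y) = N" using sumC[of "\<lambda>_. 1"] by (simp add: N_def case_prod_unfold)
  have pos: "0 < R x" "0 < C y" if "(x, y) \<in> E" for x y
    using that finR finC by (auto simp: R_def C_def card_gt_0_iff)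
  have "(\<Sum>x\<in>X. xlnx (R x)) + (\<Sum>y\<in>Y. xlnx (C y)) - xlnx N
    = (\<Sum>(x, y)\<in>E. ln (R x)) + (\<Sum>(x, y)\<in>E. ln (C y)) - (\<Sum>(x, y)\<in>E. ln N)"
    using sumR[of "\<lambda>x. ln (R x)"] sumC[of "\<lambda>y. ln (C y)"]
    by (simp add: xlnx_def N_def case_prod_unfold)
  also have "\<dots> = (\<Sum>(x, y)\<in>E. ln (R x * C y / N))"
    unfolding sum.distrib[symmetric] sum_subtractf[symmetric]
  proof (rule sum.cong)
    fix z assume "z \<in> E"
    then show "(case z of (x, y) \<Rightarrow> ln (R x)) + (case z of (x, y) \<Rightarrow> ln (C y)) - (case z of (x, y) \<Rightarrow> ln N)
      = (case z of (x, y) \<Rightarrow> ln (R x * C y / N))"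
      using pos[of "fst z" "snd z"] N by (simp add: case_prod_unfold ln_div ln_mult_pos)
  qed simp
  also have "\<dots> \<le> (\<Sum>(x, y)\<in>E. R x * C y / N - 1)"
    by (intro sum_mono) (auto intro!: ln_le_minus_one simp: N pos)
  also have "\<dots> = (\<Sum>(x, y)\<in>E. R x * C y / N) - N"
    by (simp add: case_prod_unfold sum_subtractf N_def)
  \<comment> \<open>Pairs outside \<open>E\<close> only add nonnegative terms, and over all pairs
    the sum factorises into \<open>N * N / N\<close>.\<close>
  also have "(\<Sum>(x, y)\<in>E. R x * C y / N) \<le> (\<Sum>(x, y)\<in>X \<times> Y. R x * C y / N)"
    using assms N by (intro sum_mono2) (auto simp: R_def C_def)
  also have "\<dots> = (\<Sum>x\<in>X. \<Sum>y\<in>Y. R x * C y / N)"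
    by (rule sum.cartesian_product[symmetric])
  also have "\<dots> = (\<Sum>x\<in>X. R x) * (\<Sum>y\<in>Y. C y) / N"
    unfolding sum_product sum_divide_distrib ..
  also have "\<dots> = N" using N by (simp add: totR totC)
  finally show ?thesis by (simp add: R_def C_def N_def)
qed simp

text \<open>Apply the previous bound after adding \<open>n\<close> columns joined to every row: each
  row grows by \<open>n\<close>, each new column contributes \<open>xlnx (card X)\<close>.\<close>

lemma padded_bipartite_sum_xlnx_le:
  fixes E :: "('a \<times> 'b) set" and n :: nat
  assumes "finite X" "finite Y" "E \<subseteq> X \<times> Y"
  shows "(\<Sum>x\<in>X. xlnx (n + card {y. (x, y) \<in> E})) + (\<Sum>y\<in>Y. xlnx (card {x. (x, y) \<in> E}))
    + n * xlnx (card X) \<le> xlnx (card X * n + card E)"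
proof -
  define F where "F = {(x, Inl y) | x y. (x, y) \<in> E} \<union> X \<times> Inr ` {..<n}"
  define Z :: "('b + nat) set" where "Z = Inl ` Y \<union> Inr ` {..<n}"
  have FZ: "finite Z" "F \<subseteq> X \<times> Z" using assms by (auto simp: F_def Z_def)
  have finR: "finite {y. (x, y) \<in> E}" for x
    by (rule finite_subset[of _ Y]) (use assms in auto)
  have row: "card {z. (x, z) \<in> F} = n + card {y. (x, y) \<in> E}" if "x \<in> X" for x
  proof -
    have "{z. (x, z) \<in> F} = Inr ` {..<n} \<union> Inl ` {y. (x, y) \<in> E}"
      using that by (auto simp: F_def)
    moreover have "card (Inr ` {..<n} \<union> Inl ` {y. (x, y) \<in> E})
      = card (Inr ` {..<n} :: ('b + nat) set) + card (Inl ` {y. (x, y) \<in> E} :: ('b + nat) set)"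
      by (intro card_Un_disjoint) (auto simp: finR)
    ultimately show ?thesis by (simp add: card_image)
  qed
  have col: "{x. (x, Inl y) \<in> F} = {x. (x, y) \<in> E}"
    "{x. (x, Inr i) \<in> F} = (if i < n then X else {})" for y i
    by (auto simp: F_def)
  have "card F = card X * n + card E"
    using card_eq_sum_rows[OF assms(1) FZ] card_eq_sum_rows[OF assms]
    by (simp add: row sum.distrib)
  moreover have "(\<Sum>z\<in>Z. xlnx (card {x. (x, z) \<in> F}))
    = (\<Sum>y\<in>Y. xlnx (card {x. (x, y) \<in> E})) + n * xlnx (card X)"
    unfolding Z_def using assms
    by (subst sum.union_disjoint) (auto simp: sum.reindex col)
  moreover have "(\<Sum>x\<in>X. xlnx (card {z. (x, z) \<in> F})) = (\<Sum>x\<in>X. xlnx (n + card {y. (x, y) \<in> E}))"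
    by (simp add: row)
  ultimately show ?thesis
    using bipartite_sum_xlnx_le[OF assms(1) FZ] by simp
qed

subsection \<open>Degrees and edge shifts\<close>

definition nbhd :: "'a ugraph \<Rightarrow> 'a \<Rightarrow> 'a set" where
  "nbhd G v = {u. {u, v} \<in> edges G}"

lemma nbhd_sym: "u \<in> nbhd G v \<longleftrightarrow> v \<in> nbhd G u"
  by (simp add: nbhd_def insert_commute)

lemma nbhd_simple:
  assumes "simple_graph G"
  shows "v \<notin> nbhd G v" "nbhd G v \<subseteq> verts G" "finite (nbhd G v)"
proof -
  show "v \<notin> nbhd G v"
    using assms by (force simp: simple_graph_def nbhd_def)
  show "nbhd G v \<subseteq> verts G"
    using assms by (auto simp: simple_graph_def nbhd_def)
  then show "finite (nbhd G v)"
    using assms finite_subset by (auto simp: simple_graph_def)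
qed

lemma finite_edges: "simple_graph G \<Longrightarrow> finite (edges G)"
  by (rule finite_subset[of _ "Pow (verts G)"]) (auto simp: simple_graph_def)

lemma degree_eq_card_nbhd:
  assumes "simple_graph G"
  shows "degree G v = card (nbhd G v)"
proof -
  have "{e \<in> edges G. v \<in> e} \<subseteq> (\<lambda>u. {u, v}) ` nbhd G v"
  proof
    fix e assume e: "e \<in> {e \<in> edges G. v \<in> e}"
    then have "card e = 2" using assms by (auto simp: simple_graph_def)
    then obtain u where "e = {u, v}" using e by (auto simp: card_2_iff)
    then show "e \<in> (\<lambda>u. {u, v}) ` nbhd G v" using e by (auto simp: nbhd_def)
  qed
  then have "{e \<in> edges G. v \<in> e} = (\<lambda>u. {u, v}) ` nbhd G v"
    by (auto simp: nbhd_def)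
  moreover have "inj_on (\<lambda>u. {u, v}) (nbhd G v)"
    by (auto simp: inj_on_def doubleton_eq_iff)
  ultimately show ?thesis by (simp add: degree_def card_image)
qed

lemma handshake:
  assumes "simple_graph G"
  shows "(\<Sum>v\<in>verts G. degree G v) = 2 * card (edges G)"
proof -
  let ?I = "{(v, e). e \<in> edges G \<and> v \<in> e}"
  have sub: "?I \<subseteq> verts G \<times> edges G" using assms by (auto simp: simple_graph_def)
  have fin: "finite (verts G)" "finite (edges G)"
    using assms finite_edges by (auto simp: simple_graph_def)
  have "(\<Sum>v\<in>verts G. degree G v) = card ?I"
    using card_eq_sum_rows[OF fin sub] by (simp add: degree_def)
  also have "\<dots> = (\<Sum>e\<in>edges G. card {v. e \<in> edges G \<and> v \<in> e})"
    using card_eq_sum_cols[OF fin sub] by simp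
  also have "\<dots> = (\<Sum>e\<in>edges G. 2)"
    using assms by (intro sum.cong) (auto simp: simple_graph_def)
  finally show ?thesis by simp
qed

lemma h_graph_altdef: "h_graph G = (\<Sum>v\<in>verts G. xlnx (degree G v))"
  by (simp add: h_graph_def xlnx_def)

text \<open>For a fixed number of edges, this makes the entropy a decreasing function of
  \<open>h_graph\<close>.\<close>

lemma degree_entropy_altdef:
  assumes "simple_graph G" "1 \<le> card (edges G)"
  shows "degree_entropy G = ln (2 * card (edges G)) - h_graph G / (2 * card (edges G))"
proof -
  define M where "M = 2 * real (card (edges G))"
  have M: "0 < M" using assms by (simp add: M_def)
  have "(\<Sum>v\<in>verts G. real (degree G v)) = M"
    using arg_cong[OF handshake[OF assms(1)], of real] by (simp add: M_def)
  then have "(\<Sum>v\<in>verts G. real (degree G v) / M) = 1"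
    using M by (simp flip: sum_divide_distrib)
  moreover have "degree_entropy G
    = - (\<Sum>v\<in>verts G. xlnx (degree G v) / M - real (degree G v) / M * ln M)"
    unfolding degree_entropy_def M_def[symmetric] xlnx_def
  proof (intro arg_cong[where f = uminus] sum.cong refl)
    fix v
    show "real (degree G v) / M * ln (real (degree G v) / M)
      = real (degree G v) * ln (real (degree G v)) / M - real (degree G v) / M * ln M"
      using M by (cases "degree G v = 0") (simp_all add: ln_div right_diff_distrib)
  qed
  moreover have "(\<Sum>v\<in>verts G. xlnx (degree G v) / M - real (degree G v) / M * ln M)
    = h_graph G / M - (\<Sum>v\<in>verts G. real (degree G v) / M) * ln M"
    unfolding h_graph_altdef sum_subtractf sum_divide_distrib sum_distrib_right ..
  ultimately have "degree_entropy G = ln M - h_graph G / M" by simp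
  then show ?thesis by (simp add: M_def)
qed

text \<open>Replacing the edge \<open>{v, w}\<close> by \<open>{u, w}\<close> moves one unit of
  degree from \<open>v\<close> to \<open>u\<close>, and \<open>xlnx_strict_exchange\<close> makes
  the gain strict.\<close>

lemma h_graph_less_shift:
  assumes G: "simple_graph G" and "u \<in> verts G" "u \<noteq> v" "w \<noteq> u"
    and w: "w \<in> nbhd G v" "w \<notin> nbhd G u" and le: "degree G v \<le> degree G u"
  obtains G' where "simple_graph G'" "verts G' = verts G" "card (edges G') = card (edges G)"
    "h_graph G < h_graph G'"
proof
  define G' where "G' = \<lparr>verts = verts G, edges = insert {u, w} (edges G - {{v, w}})\<rparr>"
  have vw: "{v, w} \<in> edges G" "{u, w} \<notin> edges G" "v \<noteq> w"
    using w nbhd_simple[OF G] by (auto simp: nbhd_def insert_commute)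
  have v: "v \<in> verts G" "w \<in> verts G" using vw G by (auto simp: simple_graph_def)
  show G': "simple_graph G'"
    using assms v by (auto simp: G'_def simple_graph_def card_2_iff)
  show "verts G' = verts G" by (simp add: G'_def)
  show "card (edges G') = card (edges G)"
    using vw finite_edges[OF G] by (simp add: G'_def card.insert_remove card_Diff_singleton card_gt_0_iff)
      (metis Suc_pred card_gt_0_iff empty_iff)
  \<comment> \<open>The vertex \<open>w\<close> trades its neighbour \<open>v\<close> for
    \<open>u\<close>, so its degree stays the same.\<close>
  have nb: "nbhd G' x = (if x = u then insert w (nbhd G u) else if x = v then nbhd G v - {w}
      else if x = w then insert u (nbhd G w - {v}) else nbhd G x)" for x
    using assms vw by (auto simp: nbhd_def G'_def doubleton_eq_iff insert_commute)
  have fin: "finite (nbhd G x)" for x using nbhd_simple[OF G] by blast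
  have du: "degree G' u = Suc (degree G u)"
    using w by (simp add: degree_eq_card_nbhd G G' nb fin)
  have dv: "degree G' v = degree G v - 1"
    using w assms by (simp add: degree_eq_card_nbhd G G' nb fin card_Diff_singleton)
  have dw: "degree G' w = degree G w"
    using w assms vw nbhd_sym[of v G w] nbhd_sym[of u G w] card_Suc_Diff1[OF fin, of v w]
    by (simp add: degree_eq_card_nbhd G G' nb fin del: card_Diff_insert card_Diff_singleton)
  have d: "degree G' x = degree G x" if "x \<notin> {u, v}" for x
    using that dw by (cases "x = w") (auto simp: degree_eq_card_nbhd G G' nb)
  have dv1: "1 \<le> degree G v"
    using w fin by (simp add: degree_eq_card_nbhd G Suc_le_eq card_gt_0_iff) blast
  have split: "verts G = {u, v} \<union> (verts G - {u, v})" using assms v by auto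
  have finV: "finite (verts G)" using G by (simp add: simple_graph_def)
  have sum: "(\<Sum>x\<in>verts G. F x) = F u + F v + (\<Sum>x\<in>verts G - {u, v}. F x)" for F :: "'a \<Rightarrow> real"
    by (subst split, subst sum.union_disjoint) (use finV assms in auto)
  have "(\<Sum>x\<in>verts G - {u, v}. xlnx (degree G' x)) = (\<Sum>x\<in>verts G - {u, v}. xlnx (degree G x))"
    by (intro sum.cong) (auto simp: d)
  then show "h_graph G < h_graph G'"
    using xlnx_strict_exchange[OF dv1 le]
    by (simp add: h_graph_altdef \<open>verts G' = verts G\<close> sum du dv)
qed

text \<open>For simple graphs these are the threshold graphs. The vertex \<open>u\<close> is removed
  because it may be a neighbour of \<open>v\<close> but never of itself.\<close>

definition nested :: "'a ugraph \<Rightarrow> bool" where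
  "nested G \<longleftrightarrow> (\<forall>u\<in>verts G. \<forall>v\<in>verts G. degree G v \<le> degree G u \<longrightarrow> nbhd G v - {u} \<subseteq> nbhd G u)"

text \<open>Finitely many graphs share the vertex set and the number of edges. One that maximises
  \<open>h_graph\<close> is nested, since a violation would permit an improving shift.\<close>

lemma ex_nested_ge:
  fixes G :: "'a ugraph"
  assumes "simple_graph G"
  obtains G' :: "'a ugraph" where "simple_graph G'" "card (edges G') = card (edges G)"
    "h_graph G \<le> h_graph G'" "nested G'"
proof -
  define F where "F = {G'. simple_graph G' \<and> verts G' = verts G \<and> card (edges G') = card (edges G)}"
  have "F \<subseteq> (\<lambda>E. \<lparr>verts = verts G, edges = E\<rparr>) ` Pow (Pow (verts G))"
  proof
    fix X assume "X \<in> F"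
    then have "X = \<lparr>verts = verts G, edges = edges X\<rparr>" "edges X \<in> Pow (Pow (verts G))"
      by (auto simp: F_def simple_graph_def)
    then show "X \<in> (\<lambda>E. \<lparr>verts = verts G, edges = E\<rparr>) ` Pow (Pow (verts G))"
      by (rule image_eqI)
  qed
  moreover have "finite (Pow (Pow (verts G)))" using assms by (simp add: simple_graph_def)
  ultimately have fin: "finite F" by (meson finite_imageI finite_subset)
  have "G \<in> F" using assms by (simp add: F_def)
  then have "Max (h_graph ` F) \<in> h_graph ` F" using fin by (intro Max_in) auto
  then obtain G' where G': "G' \<in> F" "h_graph G' = Max (h_graph ` F)" by force
  have max: "h_graph X \<le> h_graph G'" if "X \<in> F" for X
    using that fin G' by simp
  have "nested G'"
    unfolding nested_def
  proof (intro ballI impI subsetI)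
    fix u v w
    assume uv: "u \<in> verts G'" "v \<in> verts G'" "degree G' v \<le> degree G' u" "w \<in> nbhd G' v - {u}"
    show "w \<in> nbhd G' u"
    proof (rule ccontr)
      assume w: "w \<notin> nbhd G' u"
      have "simple_graph G'" using G' by (simp add: F_def)
      then obtain X where "simple_graph X" "verts X = verts G'" "card (edges X) = card (edges G')"
        "h_graph G' < h_graph X"
        using h_graph_less_shift[of G' u v w] uv w by blast
      then show False using max[of X] G' by (auto simp: F_def)
    qed
  qed
  moreover have "simple_graph G'" "card (edges G') = card (edges G)"
    using G'(1) by (auto simp: F_def)
  ultimately show ?thesis using that max[OF \<open>G \<in> F\<close>] by blast
qed

text \<open>Greedy choice: keep adding a vertex with the largest \<open>d\<close> among those
  left.\<close>

lemma ex_top_set: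
  fixes d :: "'a \<Rightarrow> nat"
  assumes "finite V" "k \<le> card V"
  shows "\<exists>A\<subseteq>V. card A = k \<and> (\<forall>a\<in>A. \<forall>v\<in>V - A. d v \<le> d a)"
  using assms(2)
proof (induction k)
  case (Suc k)
  then obtain A where A: "A \<subseteq> V" "card A = k" "\<forall>a\<in>A. \<forall>v\<in>V - A. d v \<le> d a" by auto
  have "V - A \<noteq> {}" using A Suc.prems assms by auto
  then obtain x where x: "x \<in> V - A" "\<forall>v\<in>V - A. d v \<le> d x"
    using Max_in[of "d ` (V - A)"] Max_ge[of "d ` (V - A)"] assms(1)
    by (smt (verit) finite_Diff finite_imageI image_iff image_is_empty)
  have "finite A" using A assms finite_subset by blast
  then have "insert x A \<subseteq> V" "card (insert x A) = Suc k"
    "\<forall>a\<in>insert x A. \<forall>v\<in>V - insert x A. d v \<le> d a"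
    using A x by auto
  then show ?case by blast
qed auto

subsection \<open>Graphs with nested neighbourhoods\<close>

lemma real_choose_two: "2 * real (k choose 2) = real k * (real k - 1)"
  by (induction k) (simp_all add: Suc_choose_2 algebra_simps)

text \<open>Stated for naturals because on the reals \<open>xlnx\<close> decreases between 0 and
  \<open>exp (-1)\<close>.\<close>

lemma xlnx_mono_nat:
  assumes "i \<le> j"
  shows "xlnx (real i) \<le> xlnx (real j)"
proof (cases "i = 0")
  case True
  then show ?thesis by (cases "j = 0") (simp_all add: xlnx_def)
next
  case False
  with assms show ?thesis unfolding xlnx_def by (intro mult_mono) auto
qed

lemma card_edges_le_choose:
  assumes "simple_graph G"
  shows "card (edges G) \<le> card (verts G) choose 2"
proof -
  have "card (edges G) \<le> card {e. e \<subseteq> verts G \<and> card e = 2}"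
    using assms by (intro card_mono) (auto simp: simple_graph_def)
  then show ?thesis
    using assms n_subsets[of "verts G" 2] by (simp add: simple_graph_def)
qed

lemma clique_card_edges:
  assumes "simple_graph G" "finite K" and clique: "\<And>u v. u \<in> K \<Longrightarrow> v \<in> K \<Longrightarrow> u \<noteq> v \<Longrightarrow> u \<in> nbhd G v"
  shows "card K choose 2 \<le> card (edges G)"
proof -
  have "{e. e \<subseteq> K \<and> card e = 2} \<subseteq> edges G"
    using clique by (auto simp: card_2_iff nbhd_def)
  then have "card {e. e \<subseteq> K \<and> card e = 2} \<le> card (edges G)"
    using finite_edges[OF assms(1)] by (intro card_mono)
  then show ?thesis using assms(2) by (simp add: n_subsets)
qed

text \<open>\<open>A\<close> consists of \<open>k\<close> vertices of largest degree, and
  \<open>B\<close> is the neighbourhood of an outside vertex of largest degree, or empty if there is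
  none. The lower bound on the edges provides \<open>k\<close> vertices; the upper bound excludes a
  clique on \<open>k + 1\<close>.\<close>

lemma nested_structure:
  assumes G: "simple_graph G" and nested: "nested G"
    and m: "k choose 2 \<le> card (edges G)" "card (edges G) < Suc k choose 2" and k: "2 \<le> k"
  obtains A B where "B \<subseteq> A" "A \<subseteq> verts G" "card A = k"
    "\<And>u. u \<in> verts G - A \<Longrightarrow> nbhd G u \<subseteq> B"
    "\<And>v. v \<in> B \<Longrightarrow> A - {v} \<subseteq> nbhd G v"
    "B = {} \<or> (\<exists>u\<in>verts G - A. nbhd G u = B)"
proof -
  have fin: "finite (verts G)" using G by (simp add: simple_graph_def)
  have "k \<le> card (verts G)"
  proof (rule ccontr)
    assume "\<not> k \<le> card (verts G)"
    then have "card (verts G) choose 2 \<le> (k - 1) choose 2" by (intro binomial_right_mono) auto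
    moreover have "(k - 1) choose 2 < k choose 2"
      using Suc_choose_2[of "k - 1"] k by simp
    ultimately show False using card_edges_le_choose[OF G] m by linarith
  qed
  then obtain A where A: "A \<subseteq> verts G" "card A = k"
    and top: "\<And>a v. a \<in> A \<Longrightarrow> v \<in> verts G - A \<Longrightarrow> degree G v \<le> degree G a"
    using ex_top_set[OF fin, of k "degree G"] by blast
  have nest: "x \<in> nbhd G u" if "u \<in> verts G" "v \<in> verts G" "degree G v \<le> degree G u" "x \<in> nbhd G v" "x \<noteq> u"
    for u v x
    using that nested unfolding nested_def by blast
  have finA: "finite A" using A fin finite_subset by blast
  have indep: "nbhd G u \<subseteq> A" if u: "u \<in> verts G - A" for u
  proof (rule ccontr)
    \<comment> \<open>An edge between \<open>u\<close> and \<open>w\<close> outside \<open>A\<close>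
      would, by nesting, join \<open>u\<close> to all of \<open>A\<close> and then make
      \<open>insert u A\<close> a clique.\<close>
    assume "\<not> nbhd G u \<subseteq> A"
    then obtain w where w: "w \<in> nbhd G u" "w \<in> verts G - A" using nbhd_simple[OF G] by blast
    have uA: "u \<in> nbhd G a" if "a \<in> A" for a
    proof (rule nest)
      show "u \<in> nbhd G w" using w nbhd_sym by fast
    qed (use that u w A top in auto)
    have "card (insert u A) choose 2 \<le> card (edges G)"
    proof (rule clique_card_edges[OF G])
      fix x y assume xy: "x \<in> insert u A" "y \<in> insert u A" "x \<noteq> y"
      have "x \<in> nbhd G y" if "x \<in> A" "y \<in> A"
      proof (rule nest)
        show "x \<in> nbhd G u" using uA[OF that(1)] nbhd_sym by fast
      qed (use that u xy A top in auto)
      then show "x \<in> nbhd G y" using xy uA nbhd_sym[of x G y] by auto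
    qed (use finA in auto)
    then show False using m finA A u by simp
  qed
  show ?thesis
  proof (cases "verts G - A = {}")
    case True
    then show ?thesis using that[of "{}" A] A by auto
  next
    case False
    have "Max (degree G ` (verts G - A)) \<in> degree G ` (verts G - A)"
      using False fin by (intro Max_in) auto
    then obtain z where z: "z \<in> verts G - A" "degree G z = Max (degree G ` (verts G - A))"
      by force
    have zmax: "degree G u \<le> degree G z" if "u \<in> verts G - A" for u
      using that z fin by simp
    show ?thesis
    proof (rule that)
      show "nbhd G z \<subseteq> A" using indep z by blast
      show "nbhd G u \<subseteq> nbhd G z" if u: "u \<in> verts G - A" for u
      proof
        fix x assume x: "x \<in> nbhd G u"
        then have "x \<noteq> z" using indep[OF u] z by blast
        then show "x \<in> nbhd G z" using nest[of z u x] x u z zmax[OF u] by blast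
      qed
      show "A - {v} \<subseteq> nbhd G v" if v: "v \<in> nbhd G z" for v
      proof
        fix a assume a: "a \<in> A - {v}"
        then have "v \<in> nbhd G a" using nest[of a z v] v z A top[of a z] by blast
        then show "a \<in> nbhd G v" using nbhd_sym by fast
      qed
    qed (use A z in auto)
  qed
qed

text \<open>The chord bound handles \<open>P\<close>, the padded entropy bound handles
  \<open>B\<close> and \<open>S\<close> together, and \<open>tail_estimate\<close> compares their
  sum with the value of the colex graph.\<close>

lemma nested_h_graph_le:
  assumes G: "simple_graph G" and nested: "nested G"
    and m: "card (edges G) = (k choose 2) + l" and l: "l < k" and k: "2 \<le> k"
  shows "h_graph G \<le> l * xlnx k + (real k - l) * xlnx (real k - 1) + xlnx l"
proof -
  have "k choose 2 \<le> card (edges G)" "card (edges G) < Suc k choose 2"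
    using m l by (simp_all add: Suc_choose_2)
  then obtain A B where A: "B \<subseteq> A" "A \<subseteq> verts G" "card A = k"
    and SB: "\<And>u. u \<in> verts G - A \<Longrightarrow> nbhd G u \<subseteq> B"
    and BA: "\<And>v. v \<in> B \<Longrightarrow> A - {v} \<subseteq> nbhd G v"
    and Bz: "B = {} \<or> (\<exists>u\<in>verts G - A. nbhd G u = B)"
    by (rule nested_structure[OF G nested _ _ k]) blast
  define S where "S = verts G - A"
  define P where "P = A - B"
  have fin: "finite (verts G)" using G by (simp add: simple_graph_def)
  have "finite A" using A fin finite_subset by blast
  then have fins: "finite A" "finite B" "finite S" "finite P"
    using A fin finite_subset[of B A] by (auto simp: S_def P_def)
  note nb = nbhd_simple[OF G]
  define b where "b = card B"
  define c where "c = real k - 1"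
  define p where "p = real k - b"
  define r where "r v = card (nbhd G v \<inter> S)" for v
  define t where "t v = card (nbhd G v \<inter> P)" for v
  have bk: "b \<le> k" using A fins card_mono unfolding b_def by blast
  have cardP: "card P = k - b" using A fins by (simp add: P_def b_def card_Diff_subset)
  have c: "real (k - Suc 0) = c" using k by (simp add: c_def of_nat_diff)
  have degB: "degree G v = (k - 1) + r v" if v: "v \<in> B" for v
  proof -
    have "nbhd G v = (A - {v}) \<union> (nbhd G v \<inter> S)"
      using BA[OF v] nb[of v] by (auto simp: S_def)
    moreover have "card ((A - {v}) \<union> (nbhd G v \<inter> S)) = card (A - {v}) + card (nbhd G v \<inter> S)"
      by (intro card_Un_disjoint) (use fins in \<open>auto simp: S_def\<close>)
    moreover have "card (A - {v}) = k - 1" using v A fins by auto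
    ultimately show ?thesis by (simp add: degree_eq_card_nbhd[OF G] r_def)
  qed
  have degP: "degree G v = b + t v" if v: "v \<in> P" for v
  proof -
    have "u \<notin> nbhd G v" if "u \<in> S" for u
      using SB[of u] that v nbhd_sym[of u G v] by (auto simp: S_def P_def)
    moreover have "B \<subseteq> nbhd G v" using BA v A nbhd_sym[of _ G v] by (fastforce simp: P_def)
    ultimately have "nbhd G v = B \<union> (nbhd G v \<inter> P)"
      using nb[of v] by (auto simp: S_def P_def)
    moreover have "card (B \<union> (nbhd G v \<inter> P)) = card B + card (nbhd G v \<inter> P)"
      by (intro card_Un_disjoint) (use fins in \<open>auto simp: P_def\<close>)
    ultimately show ?thesis by (simp add: degree_eq_card_nbhd[OF G] t_def b_def)
  qed
  have tP: "real (t v) \<le> p - 1" if v: "v \<in> P" for v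
  proof -
    have "card (nbhd G v \<inter> P) \<le> card (P - {v})"
      using fins nb[of v] by (intro card_mono) auto
    moreover have "0 < card P" using v fins card_gt_0_iff by blast
    ultimately show ?thesis using v fins cardP by (simp add: t_def p_def of_nat_diff)
  qed
  have split: "(\<Sum>v\<in>verts G. F v) = (\<Sum>v\<in>B. F v) + (\<Sum>v\<in>P. F v) + (\<Sum>v\<in>S. F v)" for F :: "'a \<Rightarrow> real"
    using sum.subset_diff[OF A(2) fin, of F] sum.subset_diff[OF A(1) fins(1), of F]
    by (simp add: S_def P_def)
  define E where "E = {(v, u). v \<in> B \<and> u \<in> S \<and> u \<in> nbhd G v}"
  have E: "E \<subseteq> B \<times> S" by (auto simp: E_def)
  have row: "card {u. (v, u) \<in> E} = r v" if "v \<in> B" for v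
    using that by (simp add: E_def r_def Int_def conj_commute)
  have col: "card {v. (v, u) \<in> E} = degree G u" if "u \<in> S" for u
  proof -
    have "{v. (v, u) \<in> E} = nbhd G u"
      using that SB[of u] nbhd_sym[of _ G u] by (auto simp: E_def S_def)
    then show ?thesis by (simp add: degree_eq_card_nbhd[OF G])
  qed
  define s where "s = real (card E)"
  have sB: "(\<Sum>v\<in>B. real (r v)) = s"
    using card_eq_sum_rows[OF fins(2,3) E] by (simp add: row s_def)
  have sS: "(\<Sum>u\<in>S. real (degree G u)) = s"
    using card_eq_sum_cols[OF fins(2,3) E] by (simp add: col s_def)
  define T where "T = (\<Sum>v\<in>P. real (t v))"
  \<comment> \<open>As \<open>s\<close> counts the edges leaving \<open>A\<close>, this is the
    number of edges that \<open>A\<close> lacks to be a clique; all of them lie inside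
    \<open>P\<close>.\<close>
  define q where "q = s - l"
  have pP: "real (card P) = p" using cardP bk by (simp add: p_def of_nat_diff)
  have T: "0 \<le> T" "T \<le> p * (p - 1)"
  proof -
    show "0 \<le> T" by (simp add: T_def sum_nonneg)
    have "T \<le> (\<Sum>v\<in>P. p - 1)" unfolding T_def using tP by (intro sum_mono) auto
    then show "T \<le> p * (p - 1)" using pP by simp
  qed
  have "(\<Sum>v\<in>verts G. real (degree G v)) = 2 * real (card (edges G))"
    using arg_cong[OF handshake[OF G], of real] by simp
  also have "\<dots> = k * c + 2 * l" using real_choose_two[of k] by (simp add: m c_def)
  also have "(\<Sum>v\<in>verts G. real (degree G v)) = b * c + s + (p * b + T) + s"
    unfolding split by (simp add: degB degP sum.distrib sB sS c T_def[symmetric] pP b_def)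
  finally have q: "2 * q = p * (p - 1) - T"
    by (simp add: q_def p_def c_def algebra_simps)
  have h: "h_graph G = (\<Sum>v\<in>B. xlnx ((k - 1) + r v)) + (\<Sum>v\<in>P. xlnx (b + t v)) + (\<Sum>u\<in>S. xlnx (degree G u))"
    unfolding h_graph_altdef split by (simp add: degB degP)
  show ?thesis
  \<comment> \<open>The chord and product rules need \<open>b > 0\<close>. With \<open>B\<close>
    empty there are no outside edges, hence \<open>l = 0\<close>, and degrees in \<open>A\<close>
    are at most \<open>k - 1\<close>.\<close>
  proof (cases "b = 0")
    case True
    then have "B = {}" using fins by (simp add: b_def)
    then have "s = 0" using E by (simp add: s_def)
    then have l0: "l = 0" using q T by (simp add: q_def)
    have "degree G u = 0" if "u \<in> S" for u
      using col[OF that] \<open>B = {}\<close> E by auto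
    then have "h_graph G = (\<Sum>v\<in>P. xlnx (t v))" using h True \<open>B = {}\<close> by simp
    also have "\<dots> \<le> (\<Sum>v\<in>P. xlnx (real (k - 1)))"
    proof (intro sum_mono xlnx_mono_nat)
      fix v assume "v \<in> P"
      then have "real (t v) \<le> real (k - 1)" using tP[of v] True c by (simp add: p_def c_def)
      then show "t v \<le> k - 1" by simp
    qed
    finally show ?thesis using l0 cardP True c by (simp add: c_def)
  next
    case False
    \<comment> \<open>The vertex \<open>z\<close> alone supplies \<open>b\<close> outside edges,
      which yields the hypothesis \<open>b \<le> l + q\<close> of
      \<open>tail_estimate\<close>.\<close>
    have "B \<noteq> {}" using False by (auto simp: b_def)
    then obtain z where z: "z \<in> S" "nbhd G z = B" using Bz by (auto simp: S_def)
    have "real (degree G z) \<le> (\<Sum>u\<in>S. real (degree G u))"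
      using z fins by (intro member_le_sum) auto
    then have bs: "b \<le> s" using sS z by (simp add: degree_eq_card_nbhd[OF G] b_def)
    have "b \<noteq> k"
    proof
      assume "b = k"
      then have "q = 0" using q T by (simp add: p_def)
      then show False using bs l \<open>b = k\<close> by (simp add: q_def)
    qed
    then have blt: "b < k" using bk by simp
    \<comment> \<open>Degrees in \<open>P\<close> range from \<open>b\<close> to \<open>c\<close>,
      and \<open>D\<close> is the slope of that chord; it is 0 when \<open>b = c\<close>.\<close>
    define D where "D = (xlnx c - xlnx b) / (c - b)"
    have chord: "xlnx (b + t v) \<le> xlnx b + t v * D" if v: "v \<in> P" for v
    proof (cases "c = b")
      case True
      then have "t v = 0" using tP[OF v] by (simp add: p_def c_def)
      then show ?thesis by simp
    next
      case False
      then have "b < c" using blt by (auto simp: c_def)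
      moreover have "(xlnx (real b + real (t v)) - xlnx b) * (c - b) \<le> t v * (xlnx (b + (c - b)) - xlnx b)"
        using tP[OF v] \<open>b \<noteq> 0\<close> by (intro xlnx_chord) (auto simp: p_def c_def)
      ultimately show ?thesis by (simp add: D_def field_simps)
    qed
    have "(\<Sum>v\<in>P. xlnx (b + t v)) \<le> (\<Sum>v\<in>P. xlnx b + t v * D)"
      using chord by (intro sum_mono) auto
    also have "\<dots> = p * xlnx b + T * D"
      by (simp add: sum.distrib T_def pP sum_distrib_right)
    also have "T = p * (c - b) - 2 * q" using q by (simp add: p_def c_def)
    also have "p * xlnx b + (p * (c - b) - 2 * q) * D = p * xlnx c - 2 * q * D"
      by (cases "c = b") (auto simp: D_def field_simps)
    finally have 1: "(\<Sum>v\<in>P. xlnx (b + t v)) \<le> p * xlnx c - 2 * q * D" .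
    \<comment> \<open>The \<open>k - 1\<close> padding columns account for the neighbours of a
      vertex of \<open>B\<close> inside \<open>A\<close>.\<close>
    have 2: "(\<Sum>v\<in>B. xlnx ((k - 1) + r v)) + (\<Sum>u\<in>S. xlnx (degree G u)) + (k - 1) * xlnx b \<le> xlnx (b * c + s)"
      using padded_bipartite_sum_xlnx_le[OF fins(2,3) E, of "k - 1"]
      by (simp add: row col c s_def b_def)
    have 3: "xlnx (b * c) = b * xlnx c + c * xlnx b"
      using False k by (intro xlnx_mult) (auto simp: c_def)
    have tail: "xlnx (b * c + l + q) - xlnx (b * c) \<le> xlnx l + l * (xlnx k - xlnx c) + 2 * q * D"
      unfolding c_def D_def
    proof (rule tail_estimate)
      show "2 * q \<le> (real k - real b) * (real k - real b - 1)" "0 \<le> q" "real b \<le> real l + q"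
        using q T bs by (auto simp: p_def q_def)
    qed (use False blt l in auto)
    have "b * c + l + q = b * c + s" by (simp add: q_def)
    from 1 2 3 tail[unfolded this] show ?thesis
      using h c by (simp add: p_def c_def algebra_simps)
  qed
qed

section \<open>Degrees of the colex graph and the conclusion\<close>

lemma clique_plus_vertex_facts:
  assumes k: "2 \<le> k" and l: "l < k"
  defines "C \<equiv> clique_plus_vertex k l"
  shows "simple_graph C" "card (edges C) = (k choose 2) + l"
    "h_graph C = l * xlnx k + (real k - l) * xlnx (real k - 1) + xlnx l"
proof -
  show C: "simple_graph C"
    using l by (auto simp: C_def clique_plus_vertex_def simple_graph_def card_insert_if)
  have verts: "verts C = {..<l} \<union> {l..<k} \<union> {k}"
    using l by (auto simp: C_def clique_plus_vertex_def)
  have in_nb: "i \<in> nbhd C j \<longleftrightarrow> i < k \<and> j < k \<and> i \<noteq> j \<or> i < l \<and> j = k \<or> i = k \<and> j < l" for i j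
    by (auto simp: C_def nbhd_def clique_plus_vertex_def doubleton_eq_iff card_insert_if)
  have "nbhd C j = insert k ({..<k} - {j})" if "j < l" for j
    using that l by (auto simp: in_nb)
  then have d1: "degree C j = k" if "j < l" for j
    using that l by (simp add: degree_eq_card_nbhd[OF C])
  have "nbhd C j = {..<k} - {j}" if "l \<le> j" "j < k" for j
    using that l by (auto simp: in_nb)
  then have d2: "degree C j = k - 1" if "l \<le> j" "j < k" for j
    using that by (simp add: degree_eq_card_nbhd[OF C])
  have "nbhd C k = {..<l}" using l by (auto simp: in_nb)
  then have d3: "degree C k = l" by (simp add: degree_eq_card_nbhd[OF C])
  \<comment> \<open>With \<open>F\<close> arbitrary, this gives both \<open>h_graph\<close> and the
    degree sum, from which \<open>handshake\<close> yields the number of edges.\<close>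
  have sum: "(\<Sum>v\<in>verts C. F (degree C v)) = l * F k + (real k - l) * F (k - 1) + F l" for F :: "nat \<Rightarrow> real"
  proof -
    have "(\<Sum>v\<in>verts C. F (degree C v))
      = (\<Sum>v<l. F (degree C v)) + (\<Sum>v=l..<k. F (degree C v)) + F (degree C k)"
      unfolding verts using l by (subst sum.union_disjoint; (subst sum.union_disjoint)?) auto
    then show ?thesis using l by (simp add: d1 d2 d3 of_nat_diff)
  qed
  show "h_graph C = l * xlnx k + (real k - l) * xlnx (real k - 1) + xlnx l"
    unfolding h_graph_altdef using sum[of "\<lambda>d. xlnx d"] k by (simp add: of_nat_diff)
  have "2 * real (card (edges C)) = (\<Sum>v\<in>verts C. real (degree C v))"
    using arg_cong[OF handshake[OF C], of real] by simp
  also have "\<dots> = 2 * real ((k choose 2) + l)"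
    using sum[of real] real_choose_two[of k] k by (simp add: of_nat_diff algebra_simps)
  finally have "real (card (edges C)) = real ((k choose 2) + l)" by simp
  then show "card (edges C) = (k choose 2) + l" by (simp only: of_nat_eq_iff)
qed

theorem theorem2:
  fixes m :: nat
  assumes "m \<ge> 1"
  shows "simple_graph (colex_graph m) \<and> card (edges (colex_graph m)) = m \<and>
         (\<forall>G :: 'a ugraph. simple_graph G \<and> card (edges G) = m \<longrightarrow>
            h_graph G \<le> h_graph (colex_graph m) \<and>
            degree_entropy (colex_graph m) \<le> degree_entropy G)"
proof -
  obtain k l where "colex_decomp m (k, l)" using colex_decomp_ex[OF assms] by blast
  moreover from this have "(THE p. colex_decomp m p) = (k, l)"
    by (intro the1_equality colex_decomp_ex1[OF assms])
  ultimately have kl: "2 \<le> k" "l < k" "m = (k choose 2) + l"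
    and C: "colex_graph m = clique_plus_vertex k l"
    by (auto simp: colex_decomp_def colex_graph_def)
  note facts = clique_plus_vertex_facts[OF kl(1,2), folded C kl(3)]
  have h: "h_graph G \<le> h_graph (colex_graph m)" if G: "simple_graph G" "card (edges G) = m" for G :: "'a ugraph"
  proof -
    obtain G' :: "'a ugraph" where "simple_graph G'" "card (edges G') = m" "h_graph G \<le> h_graph G'" "nested G'"
      using ex_nested_ge[OF G(1)] G(2) by metis
    then show ?thesis
      using nested_h_graph_le[of G' k l] kl facts(3) by simp
  qed
  moreover have "degree_entropy (colex_graph m) \<le> degree_entropy G"
    if G: "simple_graph G" "card (edges G) = m" for G :: "'a ugraph"
    using h[OF G] G facts(1,2) assms
    by (simp add: degree_entropy_altdef divide_right_mono)
  ultimately show ?thesis using facts(1,2) by blast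
qed

end
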